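(* Let $\mathrm{A}$ denote one of the properties "abelian", "nilpotent", "solvable", and let $G$ be a finite group that does not have property $\mathrm{A}$. Then the invariable generating graph of $G$ is contained in the complement of the conjugacy super$\mathrm{A}$ graph of $G$; that is, any two distinct elements of $G$ that are adjacent in the invariable generating graph are non-adjacent in the conjugacy super$\mathrm{A}$ graph.
   Context: All graphs are simple and undirected. Let $G$ be a finite group. A set $\{x_1,\dots,x_n\}\subseteq G$ invariably generates $G$ if for all $g_1,\dots,g_n\in G$ the set $\{x_1^{g_1},\dots,x_n^{g_n}\}$ generates $G$, where $x^g$ denotes the conjugate of $x$ by $g$. The invariable generating graph of $G$ has vertex set $G$, two distinct elements being adjacent if and only if they invariably generate $G$. For $\mathrm{A}$ one of the properties abelian, nilpotent, solvable, let $\mathrm{A}(G)$ be the graph with vertex set $G$ in which distinct $g,h$ are adjacent if and only if $\langle g,h\rangle$ has property $\mathrm{A}$ (so for "abelian" this is the commuting graph: $gh=hg$). The conjugacy super$\mathrm{A}$ graph of $G$ has vertex set $G$; distinct $g,h\in G$ are adjacent if and only if either $g$ and $h$ are conjugate in $G$, or there exist a conjugate $g'$ of $g$ and a conjugate $h'$ of $h$ that are adjacent in $\mathrm{A}(G)$. *)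

theory Defs
  imports "HOL-Algebra.Solvable_Groups" "Graph_Theory.Graph_Theory"
begin

section \<open>Simple graphs\<close>

text \<open>Simple undirected graphs are the \<^locale>\<open>pair_graph\<close>s of the Graph_Theory entry: an edge
  between \<open>u\<close> and \<open>v\<close> is the pair of arcs \<open>(u, v)\<close> and \<open>(v, u)\<close>, and containment of graphs is
  \<^const>\<open>subgraph\<close>.\<close>

definition graph_on :: "'a set \<Rightarrow> ('a \<Rightarrow> 'a \<Rightarrow> bool) \<Rightarrow> 'a pair_pre_digraph" where
  "graph_on V adj =
    \<lparr> pverts = V, parcs = {(u, v). u \<in> V \<and> v \<in> V \<and> u \<noteq> v \<and> adj u v} \<rparr>"

abbreviation adjacent_in :: "'a pair_pre_digraph \<Rightarrow> 'a \<Rightarrow> 'a \<Rightarrow> bool" where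
  "adjacent_in \<Gamma> u v \<equiv> (u, v) \<in> parcs \<Gamma>"

definition graph_complement :: "'a pair_pre_digraph \<Rightarrow> 'a pair_pre_digraph" where
  "graph_complement \<Gamma> = graph_on (pverts \<Gamma>) (\<lambda>u v. \<not> adjacent_in \<Gamma> u v)"

lemma pair_graph_graph_on:
  assumes "finite V" "\<And>u v. u \<in> V \<Longrightarrow> v \<in> V \<Longrightarrow> adj u v \<Longrightarrow> adj v u"
  shows "pair_graph (graph_on V adj)"
proof -
  have "finite {(u, v). u \<in> V \<and> v \<in> V \<and> u \<noteq> v \<and> adj u v}"
    by (rule finite_subset[of _ "V \<times> V"]) (use assms in auto)
  then show ?thesis
    using assms by unfold_locales (auto simp: graph_on_def symmetric_def intro!: symI)
qed


section \<open>Conjugation and invariable generation\<close>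

definition conj_by :: "('a, 'b) monoid_scheme \<Rightarrow> 'a \<Rightarrow> 'a \<Rightarrow> 'a" where
  "conj_by G x g = inv\<^bsub>G\<^esub> g \<otimes>\<^bsub>G\<^esub> x \<otimes>\<^bsub>G\<^esub> g"

definition conjugate_in :: "('a, 'b) monoid_scheme \<Rightarrow> 'a \<Rightarrow> 'a \<Rightarrow> bool" where
  "conjugate_in G x y \<longleftrightarrow> (\<exists>g \<in> carrier G. y = conj_by G x g)"

text \<open>The conjugating elements may be chosen independently for the members of \<open>X\<close>; such a choice
  is a function \<open>c\<close> on \<open>X\<close>.\<close>

definition invariably_generates :: "('a, 'b) monoid_scheme \<Rightarrow> 'a set \<Rightarrow> bool" where
  "invariably_generates G X \<longleftrightarrow> finite X \<and> X \<subseteq> carrier G \<and>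
    (\<forall>c \<in> X \<rightarrow> carrier G. generate G ((\<lambda>x. conj_by G x (c x)) ` X) = carrier G)"

definition invariable_generating_graph :: "('a, 'b) monoid_scheme \<Rightarrow> 'a pair_pre_digraph" where
  "invariable_generating_graph G =
    graph_on (carrier G) (\<lambda>g h. invariably_generates G {g, h})"


section \<open>Abelian, nilpotent and solvable groups\<close>

definition commutator_subgroup :: "('a, 'b) monoid_scheme \<Rightarrow> 'a set \<Rightarrow> 'a set \<Rightarrow> 'a set" where
  "commutator_subgroup G H K =
    generate G (\<Union>h \<in> H. \<Union>k \<in> K. {h \<otimes>\<^bsub>G\<^esub> k \<otimes>\<^bsub>G\<^esub> inv\<^bsub>G\<^esub> h \<otimes>\<^bsub>G\<^esub> inv\<^bsub>G\<^esub> k})"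

primrec lower_central_series :: "('a, 'b) monoid_scheme \<Rightarrow> nat \<Rightarrow> 'a set" where
  "lower_central_series G 0 = carrier G"
| "lower_central_series G (Suc n) = commutator_subgroup G (lower_central_series G n) (carrier G)"

definition nilpotent_group :: "('a, 'b) monoid_scheme \<Rightarrow> bool" where
  "nilpotent_group G \<longleftrightarrow> group G \<and> (\<exists>n. lower_central_series G n = {\<one>\<^bsub>G\<^esub>})"

datatype group_property = Abelian | Nilpotent | Solvable

primrec has_property :: "group_property \<Rightarrow> ('a, 'b) monoid_scheme \<Rightarrow> bool" where
  "has_property Abelian G \<longleftrightarrow> comm_group G"
| "has_property Nilpotent G \<longleftrightarrow> nilpotent_group G"
| "has_property Solvable G \<longleftrightarrow> group G \<and> solvable G"


section \<open>The graph of a property and its conjugacy supergraph\<close>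

definition property_graph ::
    "group_property \<Rightarrow> ('a, 'b) monoid_scheme \<Rightarrow> 'a pair_pre_digraph" where
  "property_graph A G =
    graph_on (carrier G) (\<lambda>g h. has_property A (G\<lparr>carrier := generate G {g, h}\<rparr>))"

definition conjugacy_super_graph ::
    "group_property \<Rightarrow> ('a, 'b) monoid_scheme \<Rightarrow> 'a pair_pre_digraph" where
  "conjugacy_super_graph A G =
    graph_on (carrier G) (\<lambda>g h. conjugate_in G g h \<or>
      (\<exists>g' h'. conjugate_in G g g' \<and> conjugate_in G h h' \<and>
        adjacent_in (property_graph A G) g' h'))"

lemma (in group) conjugate_in_sym:
  assumes "conjugate_in G x y" "x \<in> carrier G"
  shows "conjugate_in G y x"
proof -
  from assms obtain g where g: "g \<in> carrier G" "y = inv g \<otimes> x \<otimes> g"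
    by (auto simp: conjugate_in_def conj_by_def)
  then have "x = conj_by G y (inv g)"
    using assms(2) by (simp add: conj_by_def m_assoc flip: m_assoc[of g "inv g" x])
  then show ?thesis
    using g(1) by (auto simp: conjugate_in_def)
qed

lemma (in group) pair_graph_invariable_generating_graph:
  "finite (carrier G) \<Longrightarrow> pair_graph (invariable_generating_graph G)"
  unfolding invariable_generating_graph_def
  by (rule pair_graph_graph_on) (simp_all add: insert_commute)

lemma (in group) pair_graph_property_graph:
  "finite (carrier G) \<Longrightarrow> pair_graph (property_graph A G)"
  unfolding property_graph_def by (rule pair_graph_graph_on) (simp_all add: insert_commute)

lemma (in group) pair_graph_conjugacy_super_graph:
  assumes "finite (carrier G)"
  shows "pair_graph (conjugacy_super_graph A G)"
proof -
  have "adjacent_in (property_graph A G) v u" if "adjacent_in (property_graph A G) u v" for u v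
    using that by (auto simp: property_graph_def graph_on_def insert_commute)
  then show ?thesis
    unfolding conjugacy_super_graph_def
    by (intro pair_graph_graph_on assms) (meson conjugate_in_sym)
qed

text \<open>For the property ``abelian'' the property graph is the commuting graph.\<close>

lemma (in group) adjacent_in_property_graph_Abelian:
  assumes "g \<in> carrier G" "h \<in> carrier G"
  shows "adjacent_in (property_graph Abelian G) g h \<longleftrightarrow> g \<noteq> h \<and> g \<otimes> h = h \<otimes> g"
proof -
  let ?H = "generate G {g, h}"
  have sub: "subgroup ?H G"
    using assms by (intro generate_is_subgroup) auto
  have *: "comm_group (G\<lparr>carrier := ?H\<rparr>) \<longleftrightarrow> g \<otimes> h = h \<otimes> g"
  proof
    assume "comm_group (G\<lparr>carrier := ?H\<rparr>)"
    then interpret H: comm_group "G\<lparr>carrier := ?H\<rparr>" .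
    show "g \<otimes> h = h \<otimes> g"
      using H.m_comm[of g h] by (simp add: generate.incl)
  next
    assume comm: "g \<otimes> h = h \<otimes> g"
    show "comm_group (G\<lparr>carrier := ?H\<rparr>)"
    proof (rule group.group_comm_groupI)
      show "group (G\<lparr>carrier := ?H\<rparr>)"
        using sub by (rule subgroup.subgroup_is_group) (rule is_group)
    next
      have C: "x \<in> carrier G" if "x \<in> ?H" for x
        using that assms generate_in_carrier[of "{g, h}" x] by auto
      have inv_comm: "x \<otimes> inv y = inv y \<otimes> x"
        if "x \<otimes> y = y \<otimes> x" "x \<in> carrier G" "y \<in> carrier G" for x y
        using that by (metis inv_closed inv_solve_left inv_solve_right m_assoc m_closed)
      have mult_comm: "x \<otimes> (y \<otimes> z) = y \<otimes> z \<otimes> x"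
        if "x \<otimes> y = y \<otimes> x" "x \<otimes> z = z \<otimes> x" "x \<in> carrier G" "y \<in> carrier G" "z \<in> carrier G"
        for x y z
        using that by (metis m_assoc)
      have gen: "x \<otimes> y = y \<otimes> x"
        if "y \<in> ?H" "x \<in> carrier G" "x \<otimes> g = g \<otimes> x" "x \<otimes> h = h \<otimes> x" for x y
        using that(1)
      proof induction
        case (eng y z)
        then show ?case using that C mult_comm by blast
      qed (use that assms inv_comm in auto)
      fix x y
      assume "x \<in> carrier (G\<lparr>carrier := ?H\<rparr>)" "y \<in> carrier (G\<lparr>carrier := ?H\<rparr>)"
      moreover have "x \<otimes> g = g \<otimes> x" "x \<otimes> h = h \<otimes> x" if "x \<in> ?H" for x
        using gen[OF that, of g] gen[OF that, of h] assms comm by auto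
      ultimately show "x \<otimes>\<^bsub>G\<lparr>carrier := ?H\<rparr>\<^esub> y = y \<otimes>\<^bsub>G\<lparr>carrier := ?H\<rparr>\<^esub> x"
        using gen C by auto
    qed
  qed
  show ?thesis
    using assms * by (auto simp: property_graph_def graph_on_def)
qed

end

theory Submission
  imports Defs "HOL-Algebra.Elementary_Groups"
begin

text \<open>If \<open>g\<close> and \<open>h\<close> invariably generate \<open>G\<close>, then
  every pair of conjugates \<open>g'\<close>, \<open>h'\<close> generates \<open>G\<close>
  (\<open>generate_conjugates_of_invariably_generates\<close>). Suppose they were also adjacent in
  the super graph. If some \<open>g'\<close>, \<open>h'\<close> generate a subgroup with property
  \<open>A\<close>, that subgroup is \<open>G\<close>, a contradiction. If \<open>g\<close> and
  \<open>h\<close> are conjugate, \<open>h\<close> serves as conjugate of both, so \<open>G\<close>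
  is generated by \<open>h\<close> alone; it is then cyclic, hence abelian, and abelian groups have
  each of the three properties (\<open>has_property_of_comm\<close>).\<close>

lemma graph_on_subgraph:
  assumes "\<And>u v. u \<in> V \<Longrightarrow> v \<in> V \<Longrightarrow> u \<noteq> v \<Longrightarrow> adj u v \<Longrightarrow> adj' u v"
  shows "subgraph (with_proj (graph_on V adj)) (with_proj (graph_on V adj'))"
proof -
  have "pair_wf_digraph (graph_on V P)" for P
    by unfold_locales (auto simp: graph_on_def)
  then show ?thesis
    using assms unfolding subgraph_def wf_digraph_wp_iff compatible_def
    by (auto simp: graph_on_def)
qed

text \<open>This set generates both the first proper term of the lower central series and the
  derived subgroup, so one computation serves nilpotency and solvability.\<close>

lemma (in comm_group) commutators_trivial:
  "(\<Union>h\<in>carrier G. \<Union>k\<in>carrier G. {h \<otimes> k \<otimes> inv h \<otimes> inv k}) = {\<one>}"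
proof -
  have "h \<otimes> k \<otimes> inv h \<otimes> inv k = \<one>" if "h \<in> carrier G" "k \<in> carrier G" for h k
    using that by (metis inv_closed inv_solve_right l_one m_assoc m_closed m_comm r_inv)
  then show ?thesis
    by auto
qed

lemma (in comm_group) has_property_of_comm: "has_property A G"
proof (cases A)
  case Abelian
  then show ?thesis
    by (simp add: comm_group_axioms)
next
  case Nilpotent
  have "lower_central_series G (Suc 0) = {\<one>}"
    by (simp add: commutator_subgroup_def commutators_trivial generate_one)
  then show ?thesis
    using is_group unfolding Nilpotent has_property.simps nilpotent_group_def by blast
next
  case Solvable
  have "((derived G) ^^ 1) (carrier G) = {\<one>}"
    by (simp add: derived_def commutators_trivial generate_one)
  then show ?thesis
    using is_group subgroup_self trivial_derived_seq_imp_solvable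
    unfolding Solvable has_property.simps solvable_def by blast
qed

lemma (in group) comm_group_of_generate_singleton:
  assumes "x \<in> carrier G" "generate G {x} = carrier G"
  shows "comm_group G"
  \<comment> \<open>The hypothesis says that \<open>subgroup_generated G {x}\<close> is
    \<open>G\<close> itself, which is how the library defines a cyclic group.\<close>
  using assms by (intro cyclic_imp_abelian_group)
    (auto simp: cyclic_group_def subgroup_generated_def intro!: bexI[of _ x])

lemma (in group) generate_conjugates_of_invariably_generates:
  assumes "invariably_generates G {g, h}" "g \<noteq> h" "conjugate_in G g g'" "conjugate_in G h h'"
  shows "generate G {g', h'} = carrier G"
proof -
  obtain a b where ab: "a \<in> carrier G" "b \<in> carrier G" "g' = conj_by G g a" "h' = conj_by G h b"
    using assms(3,4) by (auto simp: conjugate_in_def)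
  \<comment> \<open>Conjugators are given by one function on the set \<open>{g, h}\<close>; as
    \<open>g \<noteq> h\<close>, it can take the values \<open>a\<close> and \<open>b\<close>
    independently.\<close>
  define c where "c x = (if x = g then a else b)" for x
  have "c \<in> {g, h} \<rightarrow> carrier G"
    using ab by (simp add: c_def)
  then have "generate G ((\<lambda>x. conj_by G x (c x)) ` {g, h}) = carrier G"
    using assms(1) unfolding invariably_generates_def by blast
  then show ?thesis
    using ab assms(2) by (simp add: c_def)
qed

lemma (in group) conjugate_in_refl:
  "x \<in> carrier G \<Longrightarrow> conjugate_in G x x"
  by (auto simp: conjugate_in_def conj_by_def intro!: bexI[of _ \<one>])

theorem proposition3p2:
  fixes G :: "('a, 'b) monoid_scheme" and A :: group_property
  assumes "group G"
    and "finite (carrier G)"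
    and "\<not> has_property A G"
  shows "subgraph (with_proj (invariable_generating_graph G))
           (with_proj (graph_complement (conjugacy_super_graph A G))) \<and>
    (\<forall>g \<in> carrier G. \<forall>h \<in> carrier G. g \<noteq> h \<longrightarrow>
      adjacent_in (invariable_generating_graph G) g h \<longrightarrow>
      \<not> adjacent_in (conjugacy_super_graph A G) g h)"
proof -
  interpret group G by fact
  let ?I = "invariable_generating_graph G" and ?S = "conjugacy_super_graph A G"
  have nonadj: "\<not> adjacent_in ?S g h" if "adjacent_in ?I g h" for g h
  proof
    assume "adjacent_in ?S g h"
    from that have gh: "g \<in> carrier G" "h \<in> carrier G" "g \<noteq> h" "invariably_generates G {g, h}"
      by (auto simp: invariable_generating_graph_def graph_on_def)
    from \<open>adjacent_in ?S g h\<close> consider "conjugate_in G g h"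
      | g' h' where "conjugate_in G g g'" "conjugate_in G h h'"
          "has_property A (G\<lparr>carrier := generate G {g', h'}\<rparr>)"
      by (auto simp: conjugacy_super_graph_def property_graph_def graph_on_def)
    then show False
    proof cases
      case 1
      \<comment> \<open>Take \<open>g' = h\<close> by conjugacy and \<open>h' = h\<close> by
        reflexivity; the pair collapses to a singleton.\<close>
      then have "generate G {h} = carrier G"
        using generate_conjugates_of_invariably_generates[OF gh(4,3) _ conjugate_in_refl] gh(2)
        by fastforce
      then show False
        using comm_group_of_generate_singleton[OF gh(2)] comm_group.has_property_of_comm assms(3)
        by blast
    next
      case 2
      \<comment> \<open>The generated subgroup has carrier \<open>carrier G\<close>, so updating the
        carrier gives back \<open>G\<close>, which lacks \<open>A\<close>.\<close>
      then show False
        using generate_conjugates_of_invariably_generates[OF gh(4,3)] assms(3) by simp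
    qed
  qed
  have "subgraph (with_proj ?I) (with_proj (graph_complement ?S))"
  proof -
    have verts: "pverts ?S = carrier G"
      by (simp add: conjugacy_super_graph_def graph_on_def)
    show ?thesis
      \<comment> \<open>With \<open>verts\<close>, both graphs become \<open>graph_on\<close> over
        \<open>carrier G\<close>, so only adjacency has to be compared.\<close>
      unfolding graph_complement_def verts invariable_generating_graph_def
      by (rule graph_on_subgraph)
        (use nonadj in \<open>simp add: invariable_generating_graph_def graph_on_def\<close>)
  qed
  then show ?thesis
    using nonadj by blast
qed

end
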